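(* For every positive integer $j$, there exists a $(j+1)$-edge-removable Skolem circle of order $(3^{j+1}-1)/2$.
   Context: Let $C_{2m}$ be the cycle graph with vertices $v_1,\dots,v_{2m}$ in cyclic order. A Skolem circle of order $m$ is a labelling of the vertices of $C_{2m}$ by labels from $\{1,\dots,m\}$ such that each label is used exactly twice and any two vertices with the same label $s$ are at distance exactly $s$ in $C_{2m}$. An edge $e$ of $C_{2m}$ is removable if in the path $C_{2m}-e$ any two vertices with the same label $s$ are still at distance exactly $s$. A Skolem circle is $k$-edge-removable if it has $k$ removable edges. *)

theory Defs
  imports "Graph_Theory.Graph_Theory"
begin

text \<open>
  Undirected graphs are symmetric digraphs, so an undirected edge is the set
  \<open>{u, v}\<close> of the two ends of a pair of opposite arcs, and deleting it deletes both arcs.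
\<close>

definition edges :: "'a pair_pre_digraph \<Rightarrow> 'a set set" where
  "edges G = {{u, v} | u v. (u, v) \<in> parcs G}"

definition delete_edge :: "'a pair_pre_digraph \<Rightarrow> 'a set \<Rightarrow> 'a pair_pre_digraph" where
  "delete_edge G e = G\<lparr>parcs := {(u, v) \<in> parcs G. {u, v} \<noteq> e}\<rparr>"

definition distance :: "'a pair_pre_digraph \<Rightarrow> 'a \<Rightarrow> 'a \<Rightarrow> ereal" where
  "distance G u v = wf_digraph.\<mu> (with_proj G) (\<lambda>_. 1) u v"

text \<open>The vertices \<open>0, \<dots>, n - 1\<close> play the role of \<open>v\<^sub>1, \<dots>, v\<^sub>n\<close>.\<close>

definition cycle_graph :: "nat \<Rightarrow> nat pair_pre_digraph" where
  "cycle_graph n = \<lparr>pverts = {..<n},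
     parcs = {(u, v). u < n \<and> v < n \<and> (v = Suc u mod n \<or> u = Suc v mod n)}\<rparr>"

definition labels_are_distances :: "'a pair_pre_digraph \<Rightarrow> ('a \<Rightarrow> nat) \<Rightarrow> bool" where
  "labels_are_distances G L \<longleftrightarrow>
     (\<forall>u\<in>pverts G. \<forall>v\<in>pverts G. u \<noteq> v \<and> L u = L v \<longrightarrow> distance G u v = ereal (real (L u)))"

definition skolem_circle :: "nat \<Rightarrow> (nat \<Rightarrow> nat) \<Rightarrow> bool" where
  "skolem_circle m L \<longleftrightarrow>
     (\<forall>v\<in>pverts (cycle_graph (2 * m)). L v \<in> {1..m}) \<and>
     (\<forall>s\<in>{1..m}. card {v \<in> pverts (cycle_graph (2 * m)). L v = s} = 2) \<and>
     labels_are_distances (cycle_graph (2 * m)) L"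

definition removable_edges :: "nat \<Rightarrow> (nat \<Rightarrow> nat) \<Rightarrow> nat set set" where
  "removable_edges m L =
     {e \<in> edges (cycle_graph (2 * m)).
        labels_are_distances (delete_edge (cycle_graph (2 * m)) e) L}"

text \<open>
  Having \<open>k\<close> removable edges does not exclude having more of them: up to rotation and
  reflection, the only Skolem circle of order 4 is \<open>3, 4, 2, 3, 2, 4, 1, 1\<close>, which has
  three removable edges and is to count as 2-edge-removable.
\<close>

definition edge_removable_skolem_circle :: "nat \<Rightarrow> nat \<Rightarrow> (nat \<Rightarrow> nat) \<Rightarrow> bool" where
  "edge_removable_skolem_circle k m L \<longleftrightarrow>
     skolem_circle m L \<and> k \<le> card (removable_edges m L)"

text \<open>
  The distance from the library is only specified for well-formed digraphs; the cycle graph is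
  a simple graph from three vertices on.
\<close>

lemma pair_wf_digraph_cycle_graph: "pair_wf_digraph (cycle_graph n)"
  by unfold_locales (auto simp: cycle_graph_def)

lemma pair_wf_digraph_delete_edge:
  assumes "pair_wf_digraph G"
  shows "pair_wf_digraph (delete_edge G e)"
  using assms by (auto simp: pair_wf_digraph_def delete_edge_def)

lemma pair_graph_cycle_graph:
  assumes "n \<ge> 3"
  shows "pair_graph (cycle_graph n)"
proof -
  have "finite (parcs (cycle_graph n))"
    by (rule finite_subset[of _ "{..<n} \<times> {..<n}"]) (auto simp: cycle_graph_def)
  with assms show ?thesis
    by unfold_locales
      (auto simp: cycle_graph_def mod_Suc symmetric_def sym_def split: if_splits)
qed

end

theory Submission
  imports Defs
begin

text \<open>
  A Skolem sequence of order \<open>m\<close> (a linear arrangement in which the two copies of \<open>s\<close> are exactly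
  \<open>s\<close> apart) closes up to a Skolem circle, and every edge of the circle that no pair straddles is
  removable; the closing edge is always of this kind. From a Skolem sequence of order \<open>m\<close> one gets
  one of order \<open>3 * m + 1\<close>: blow every position up to a block of three, replace the pair \<open>s\<close>
  between two blocks by the three pairs \<open>3 * s - 1\<close>, \<open>3 * s\<close>, \<open>3 * s + 1\<close>, and append the pair \<open>1, 1\<close>.
  No unstraddled edge is lost, and the edge before the appended pair is a new one. Starting from
  \<open>1, 1\<close>, after \<open>j\<close> steps there are \<open>j + 1\<close> of them.
\<close>

section \<open>Distances\<close>

lemma distance_le_path:
  assumes "pair_wf_digraph G" "p 0 \<in> pverts G"
    and "\<And>i. i < s \<Longrightarrow> (p i, p (Suc i)) \<in> parcs G"
  shows "distance G (p 0) (p s) \<le> ereal (real s)"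
proof -
  interpret wf_digraph "with_proj G"
    using assms(1) by (simp add: wf_digraph_wp_iff)
  have "awalk (p 0) (map (\<lambda>i. (p i, p (Suc i))) [0..<s]) (p s)"
    using assms(3)
  proof (induction s)
    case 0
    then show ?case using assms(2) by (simp add: awalk_Nil_iff)
  next
    case (Suc s)
    then have "awalk (p s) [(p s, p (Suc s))] (p (Suc s))"
      using wellformed[of "(p s, p (Suc s))"] by (simp add: awalk_simps)
    with Suc show ?case by (simp add: awalk_appendI)
  qed
  from min_cost_le_walk_cost[OF this, of "\<lambda>_. 1"] show ?thesis
    by (simp add: distance_def awalk_cost_def comp_def sum_list_triv)
qed

text \<open>Telescoping along a walk bounds its length below by the change of \<open>f\<close>. If
  there is no walk, the infimum is infinite.\<close>

lemma distance_ge_potential: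
  fixes f :: "'a \<Rightarrow> int"
  assumes "pair_wf_digraph G"
    and "\<And>x y. (x, y) \<in> parcs G \<Longrightarrow> f y \<le> f x + 1"
  shows "ereal (real_of_int (f v - f u)) \<le> distance G u v"
proof -
  interpret wf_digraph "with_proj G"
    using assms(1) by (simp add: wf_digraph_wp_iff)
  have "f v - f u \<le> awalk_cost (\<lambda>_. 1) p" if "awalk u p v" for p
    using that
  proof (induction p arbitrary: u)
    case Nil
    then show ?case by (simp add: awalk_simps)
  next
    case (Cons e p)
    obtain x y where e: "e = (x, y)" by fastforce
    with Cons.prems have "(x, y) \<in> parcs G" "u = x" "awalk y p v"
      by (auto simp: awalk_simps)
    with Cons.IH[of y] assms(2)[of x y] show ?case by simp
  qed
  then show ?thesis
    unfolding distance_def \<mu>_def by (auto intro!: INF_greatest)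
qed

text \<open>The potential is the cyclic distance from \<open>u\<close>. It changes by at most 1
  along every arc of the cycle, so the bound survives deletion of arcs.\<close>

lemma distance_ge_cyclic:
  assumes "pair_wf_digraph G" "parcs G \<subseteq> parcs (cycle_graph n)"
    and "u < n" "v < n"
  shows "ereal (real_of_int (min \<bar>int v - int u\<bar> (int n - \<bar>int v - int u\<bar>))) \<le> distance G u v"
proof -
  define f where "f y = min \<bar>int y - int u\<bar> (int n - \<bar>int y - int u\<bar>)" for y
  have succ: "\<bar>f (Suc x mod n) - f x\<bar> \<le> 1" if "x < n" for x
    using that assms(3) by (auto simp: f_def mod_Suc min_def abs_if)
  have "f y \<le> f x + 1" if "(x, y) \<in> parcs G" for x y
  proof -
    have "x < n" "y < n" "y = Suc x mod n \<or> x = Suc y mod n"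
      using that assms(2) by (auto simp: cycle_graph_def)
    then show ?thesis using succ[of x] succ[of y] by auto
  qed
  from distance_ge_potential[where f = f and u = u and v = v, OF assms(1) this] show ?thesis
    using assms(3) by (simp add: f_def)
qed

lemma distance_along_cycle:
  assumes "pair_wf_digraph G" "pverts G = {..<n}" "parcs G \<subseteq> parcs (cycle_graph n)"
    and arcs: "\<And>i. a \<le> i \<Longrightarrow> i < a + s \<Longrightarrow> (i, Suc i) \<in> parcs G \<and> (Suc i, i) \<in> parcs G"
    and "a + s < n" "2 * s \<le> n"
  shows "distance G a (a + s) = ereal (real s)" "distance G (a + s) a = ereal (real s)"
proof -
  have "distance G a (a + s) \<le> ereal (real s)"
    using distance_le_path[of G "\<lambda>i. a + i" s] assms by auto
  \<comment> \<open>The same segment walked backwards; \<open>- 0\<close> and \<open>- s\<close> fit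
    the shape \<open>p 0\<close>, \<open>p s\<close>.\<close>
  moreover have "distance G (a + s - 0) (a + s - s) \<le> ereal (real s)"
  proof (rule distance_le_path[of G "\<lambda>i. a + s - i" s])
    fix i assume "i < s"
    with arcs[of "a + s - Suc i"] show "(a + s - i, a + s - Suc i) \<in> parcs G"
      by (simp add: Suc_diff_Suc)
  qed (use assms in auto)
  moreover have "ereal (real s) \<le> distance G a (a + s)"
    using distance_ge_cyclic[of G n a "a + s"] assms by (simp add: min_def)
  moreover have "ereal (real s) \<le> distance G (a + s) a"
    using distance_ge_cyclic[of G n "a + s" a] assms by (simp add: min_def)
  ultimately show "distance G a (a + s) = ereal (real s)"
    and "distance G (a + s) a = ereal (real s)" by simp_all
qed

section \<open>Skolem sequences\<close>

text \<open>
  \<open>a s\<close> is the first of the two positions of the label \<open>s\<close>. Since there are \<open>2 * m\<close> positions,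
  covering all of them already forces the pairs to be disjoint.
\<close>

definition skolem_sequence :: "nat \<Rightarrow> (nat \<Rightarrow> nat) \<Rightarrow> bool" where
  "skolem_sequence m a \<longleftrightarrow>
     (\<forall>s\<in>{1..m}. a s + s < 2 * m) \<and> (\<forall>v<2 * m. \<exists>s\<in>{1..m}. v = a s \<or> v = a s + s)"

text \<open>The cut \<open>c\<close> stands for the edge from \<open>c - 1\<close> to \<open>c\<close>, and \<open>0\<close> for the closing edge.\<close>

definition cuts :: "nat \<Rightarrow> (nat \<Rightarrow> nat) \<Rightarrow> nat set" where
  "cuts m a = {c. c < 2 * m \<and> (\<forall>s\<in>{1..m}. c \<le> a s \<or> a s + s < c)}"

definition cut_edge :: "nat \<Rightarrow> nat \<Rightarrow> nat set" where
  "cut_edge n c = (if c = 0 then {n - 1, 0} else {c - 1, c})"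

text \<open>Position \<open>p\<close> becomes the block \<open>3 * p\<close>,
  \<open>3 * p + 1\<close>, \<open>3 * p + 2\<close>. The labels \<open>3 * s - 1\<close>,
  \<open>3 * s\<close>, \<open>3 * s + 1\<close> start at offsets 1, 2, 0 of the first block of
  \<open>s\<close> and end at offsets 0, 2, 1 of the second, so both blocks are filled.\<close>

lemma skolem_sequence_triple:
  assumes "skolem_sequence m a"
  defines "b \<equiv> \<lambda>t. if t = 1 then 6 * m else if t mod 3 = 0 then 3 * a (t div 3) + 2
             else if t mod 3 = 1 then 3 * a (t div 3) else 3 * a (t div 3 + 1) + 1"
  shows "skolem_sequence (3 * m + 1) b"
    and "insert (6 * m) ((\<lambda>c. 3 * c) ` cuts m a) \<subseteq> cuts (3 * m + 1) b"
proof -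
  have lt: "a s + s < 2 * m" if "s \<in> {1..m}" for s
    using assms(1) that by (auto simp: skolem_sequence_def)
  have b1: "b 1 = 6 * m" by (simp add: b_def)
  have b: "b (3 * s) = 3 * a s + 2" "b (3 * s + 1) = 3 * a s" "b (3 * s - 1) = 3 * a s + 1"
    if "s \<ge> 1" for s
  proof -
    obtain k where k: "s = Suc k" using \<open>s \<ge> 1\<close> by (cases s) auto
    then have "3 * s - 1 = 3 * k + 2" by simp
    moreover have "(3 * k + 2) mod 3 = 2" "(3 * k + 2) div 3 = k" by presburger+
    ultimately show "b (3 * s - 1) = 3 * a s + 1" by (simp add: b_def k)
    have "(3 * s + 1) mod 3 = 1" "(3 * s + 1) div 3 = s" by presburger+
    then show "b (3 * s + 1) = 3 * a s" using \<open>s \<ge> 1\<close> by (simp add: b_def)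
    show "b (3 * s) = 3 * a s + 2" by (simp add: b_def)
  qed
  have label: "t = 1 \<or> (\<exists>s\<in>{1..m}. t = 3 * s - 1 \<or> t = 3 * s \<or> t = 3 * s + 1)"
    if "t \<in> {1..3 * m + 1}" for t
  proof (cases "t = 1")
    case False
    \<comment> \<open>\<open>(t + 1) div 3\<close> is the multiple of 3 nearest to \<open>t\<close>,
      divided by 3.\<close>
    have "(t + 1) div 3 \<in> {1..m}"
      using that False unfolding atLeastAtMost_iff by presburger
    moreover have "t = 3 * ((t + 1) div 3) - 1 \<or> t = 3 * ((t + 1) div 3)
        \<or> t = 3 * ((t + 1) div 3) + 1" using False by presburger
    ultimately show ?thesis by blast
  qed simp
  have "\<exists>t\<in>{1..3 * m + 1}. v = b t \<or> v = b t + t" if "v < 2 * (3 * m + 1)" for v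
  proof (cases "v < 6 * m")
    case False
    with that have "v = b 1 \<or> v = b 1 + 1" unfolding b1 by presburger
    then show ?thesis by (intro bexI[of _ 1]) auto
  next
    case True
    then have "v div 3 < 2 * m" by presburger
    then obtain s where s: "s \<in> {1..m}" "v div 3 = a s \<or> v div 3 = a s + s"
      using assms(1) unfolding skolem_sequence_def by blast
    have "v = 3 * (v div 3) \<or> v = 3 * (v div 3) + 1 \<or> v = 3 * (v div 3) + 2" by presburger
    moreover have "s \<ge> 1" using s by simp
    moreover have "b (3 * s - 1) + (3 * s - 1) = 3 * (a s + s)"
      "b (3 * s) + 3 * s = 3 * (a s + s) + 2" "b (3 * s + 1) + (3 * s + 1) = 3 * (a s + s) + 1"
      using b[OF \<open>s \<ge> 1\<close>] \<open>s \<ge> 1\<close> by simp_all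
    ultimately have "\<exists>t\<in>{3 * s - 1, 3 * s, 3 * s + 1}. v = b t \<or> v = b t + t"
      using s(2) b[OF \<open>s \<ge> 1\<close>] by (metis insertCI)
    moreover have "{3 * s - 1, 3 * s, 3 * s + 1} \<subseteq> {1..3 * m + 1}" using s by auto
    ultimately show ?thesis by blast
  qed
  moreover have "b t + t < 2 * (3 * m + 1)" if "t \<in> {1..3 * m + 1}" for t
    using label[OF that]
  proof
    assume "\<exists>s\<in>{1..m}. t = 3 * s - 1 \<or> t = 3 * s \<or> t = 3 * s + 1"
    then obtain s where "s \<in> {1..m}" "t = 3 * s - 1 \<or> t = 3 * s \<or> t = 3 * s + 1" by blast
    with lt[of s] b[of s] show ?thesis by auto
  qed (use b1 in simp)
  ultimately show "skolem_sequence (3 * m + 1) b"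
    by (simp add: skolem_sequence_def)
  have "6 * m \<le> b t \<or> b t + t < 6 * m" if "t \<in> {1..3 * m + 1}" for t
    using label[OF that]
  proof
    assume "\<exists>s\<in>{1..m}. t = 3 * s - 1 \<or> t = 3 * s \<or> t = 3 * s + 1"
    then obtain s where "s \<in> {1..m}" "t = 3 * s - 1 \<or> t = 3 * s \<or> t = 3 * s + 1" by blast
    with lt[of s] b[of s] show ?thesis by auto
  qed (use b1 in simp)
  then have "6 * m \<in> cuts (3 * m + 1) b" by (simp add: cuts_def)
  moreover have "3 * c \<in> cuts (3 * m + 1) b" if c: "c \<in> cuts m a" for c
  proof -
    \<comment> \<open>\<open>3 * c\<close> is a block boundary, so whole blocks stay on the side of
      the cut where their positions were.\<close>
    have "3 * c \<le> b t \<or> b t + t < 3 * c" if "t \<in> {1..3 * m + 1}" for t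
      using label[OF that]
    proof
      assume "\<exists>s\<in>{1..m}. t = 3 * s - 1 \<or> t = 3 * s \<or> t = 3 * s + 1"
      then obtain s where s: "s \<in> {1..m}" "t = 3 * s - 1 \<or> t = 3 * s \<or> t = 3 * s + 1" by blast
      with c have "c \<le> a s \<or> a s + s < c" by (auto simp: cuts_def)
      with s b[of s] show ?thesis by auto
    qed (use b1 c in \<open>simp add: cuts_def\<close>)
    with c show ?thesis by (simp add: cuts_def)
  qed
  ultimately show "insert (6 * m) ((\<lambda>c. 3 * c) ` cuts m a) \<subseteq> cuts (3 * m + 1) b" by blast
qed

lemma finite_cuts: "finite (cuts m a)"
  by (rule finite_subset[of _ "{..<2 * m}"]) (auto simp: cuts_def)

text \<open>Powers of 3 are odd, so the halving is exact.\<close>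

lemma half_pow3_Suc: "(3 ^ Suc k - 1) div 2 = 3 * ((3 ^ k - 1) div 2) + (1::nat)"
proof -
  have "odd ((3::nat) ^ k)" by simp
  then obtain q where "(3::nat) ^ k = 2 * q + 1" by (elim oddE)
  then show ?thesis by simp
qed

lemma skolem_sequence_exists:
  "\<exists>a. skolem_sequence ((3 ^ (j + 1) - 1) div 2) a \<and> j + 1 \<le> card (cuts ((3 ^ (j + 1) - 1) div 2) a)"
proof (induction j)
  case 0
  have "skolem_sequence 1 (\<lambda>_. 0)" "cuts 1 (\<lambda>_. 0) = {0}"
    by (auto simp: skolem_sequence_def cuts_def)
  then show ?case by (intro exI[of _ "\<lambda>_. 0"]) simp
next
  case (Suc j)
  define m where "m = ((3::nat) ^ (j + 1) - 1) div 2"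
  obtain a where a: "skolem_sequence m a" "j + 1 \<le> card (cuts m a)"
    using Suc.IH unfolding m_def by blast
  obtain b where b: "skolem_sequence (3 * m + 1) b"
    "insert (6 * m) ((\<lambda>c. 3 * c) ` cuts m a) \<subseteq> cuts (3 * m + 1) b"
    using skolem_sequence_triple[OF a(1)] by blast
  \<comment> \<open>Old cuts lie below \<open>2 * m\<close>, so the cut before the appended pair is
    new.\<close>
  have "6 * m \<notin> (\<lambda>c. 3 * c) ` cuts m a" by (auto simp: cuts_def)
  then have "Suc j + 1 \<le> card (insert (6 * m) ((\<lambda>c. 3 * c) ` cuts m a))"
    using a(2) finite_cuts[of m a] by (simp add: card_image inj_on_def)
  also have "\<dots> \<le> card (cuts (3 * m + 1) b)"
    by (rule card_mono[OF finite_cuts b(2)])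
  finally show ?case
    using b(1) half_pow3_Suc[of "j + 1"] unfolding m_def by auto
qed

section \<open>Closing up a Skolem sequence\<close>

lemma skolem_sequence_disjoint:
  assumes "skolem_sequence m a" "s \<in> {1..m}" "t \<in> {1..m}"
    and "{a s, a s + s} \<inter> {a t, a t + t} \<noteq> {}"
  shows "s = t"
proof -
  \<comment> \<open>\<open>d\<close> selects the second copy. There are as many slots
    \<open>(s, d)\<close> as positions, so surjectivity gives injectivity.\<close>
  let ?f = "\<lambda>(s, d::bool). if d then a s + s else a s"
  have "?f ` ({1..m} \<times> UNIV) = {..<2 * m}"
  proof (intro equalityI subsetI)
    fix v assume "v \<in> {..<2 * m}"
    then obtain s where s: "s \<in> {1..m}" "v = a s \<or> v = a s + s"
      using assms(1) unfolding skolem_sequence_def by blast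
    then have "v = ?f (s, v \<noteq> a s)" by auto
    with s(1) show "v \<in> ?f ` ({1..m} \<times> UNIV)" by blast
  next
    fix v assume "v \<in> ?f ` ({1..m} \<times> UNIV)"
    then obtain s d where "s \<in> {1..m}" "v = ?f (s, d)" by blast
    moreover from this have "a s + s < 2 * m" using assms(1) by (simp add: skolem_sequence_def)
    ultimately show "v \<in> {..<2 * m}" by (auto split: if_splits)
  qed
  then have inj: "inj_on ?f ({1..m} \<times> UNIV)"
    by (intro eq_card_imp_inj_on) (auto simp: card_cartesian_product)
  obtain v where v: "v \<in> {a s, a s + s}" "v \<in> {a t, a t + t}" using assms(4) by blast
  have f: "?f (r, v \<noteq> a r) = v" if "v \<in> {a r, a r + r}" for r
    using that by (cases "v = a r") simp_all
  have "?f (s, v \<noteq> a s) = ?f (t, v \<noteq> a t)" unfolding f[OF v(1)] f[OF v(2)] ..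
  from inj_onD[OF inj this] assms(2,3) show ?thesis by simp
qed

lemma skolem_circle_of_sequence:
  assumes a: "skolem_sequence m a" and "m \<ge> 2"
  shows "\<exists>L. edge_removable_skolem_circle (card (cuts m a)) m L"
proof -
  have lt: "a s + s < 2 * m" if "s \<in> {1..m}" for s
    using a that by (auto simp: skolem_sequence_def)
  have "\<forall>v<2 * m. \<exists>s. s \<in> {1..m} \<and> v \<in> {a s, a s + s}"
    using a unfolding skolem_sequence_def by blast
  then obtain L where L: "\<And>v. v < 2 * m \<Longrightarrow> L v \<in> {1..m} \<and> v \<in> {a (L v), a (L v) + L v}"
    by metis
  have "{v. v < 2 * m \<and> L v = s} = {a s, a s + s}" if s: "s \<in> {1..m}" for s
  proof -
    have "L v = s" if "v \<in> {a s, a s + s}" for v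
    proof (rule skolem_sequence_disjoint[OF a _ s])
      have "v < 2 * m" using that lt[OF s] by auto
      from L[OF this] show "L v \<in> {1..m}" "{a (L v), a (L v) + L v} \<inter> {a s, a s + s} \<noteq> {}"
        using that by blast+
    qed
    then show ?thesis using L lt[OF s] by fastforce
  qed
  then have card: "card {v. v < 2 * m \<and> L v = s} = 2" if "s \<in> {1..m}" for s
    using that by (simp add: card_insert_if)
  \<comment> \<open>Stated for subgraphs so that it serves both the cycle and the cycle without a
    cut edge: only the arcs between the two copies of a label must be present.\<close>
  have dist: "labels_are_distances G L"
    if G: "pair_wf_digraph G" "pverts G = {..<2 * m}" "parcs G \<subseteq> parcs (cycle_graph (2 * m))"
      and arcs: "\<And>s i. s \<in> {1..m} \<Longrightarrow> a s \<le> i \<Longrightarrow> i < a s + s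
        \<Longrightarrow> (i, Suc i) \<in> parcs G \<and> (Suc i, i) \<in> parcs G" for G
    unfolding labels_are_distances_def
  proof (intro ballI impI)
    fix u v assume "u \<in> pverts G" "v \<in> pverts G" and uv: "u \<noteq> v \<and> L u = L v"
    then have "L u \<in> {1..m}" "{u, v} \<subseteq> {a (L u), a (L u) + L u}"
      using L[of u] L[of v] G(2) by auto
    moreover from this have "distance G (a (L u)) (a (L u) + L u) = ereal (real (L u))"
      "distance G (a (L u) + L u) (a (L u)) = ereal (real (L u))"
      using distance_along_cycle[OF G, of "a (L u)" "L u"] arcs[of "L u"] lt[of "L u"] by auto
    ultimately show "distance G u v = ereal (real (L u))" using uv
      by (metis insert_iff insert_subset singletonD)
  qed
  have arc: "(i, Suc i) \<in> parcs (cycle_graph (2 * m)) \<and> (Suc i, i) \<in> parcs (cycle_graph (2 * m))"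
    if "s \<in> {1..m}" "a s \<le> i" "i < a s + s" for s i
    using that lt[of s] by (auto simp: cycle_graph_def)
  have "skolem_circle m L"
    unfolding skolem_circle_def
    using L card dist[OF pair_wf_digraph_cycle_graph] arc by (auto simp: cycle_graph_def)
  moreover have "cut_edge (2 * m) ` cuts m a \<subseteq> removable_edges m L"
  proof
    fix e assume "e \<in> cut_edge (2 * m) ` cuts m a"
    then obtain c where c: "c \<in> cuts m a" and e: "e = cut_edge (2 * m) c" by blast
    then have "c < 2 * m" by (simp add: cuts_def)
    then have "e \<in> edges (cycle_graph (2 * m))"
    proof (cases "c = 0")
      case True
      with \<open>m \<ge> 2\<close> have "(2 * m - 1, 0) \<in> parcs (cycle_graph (2 * m))"
        by (auto simp: cycle_graph_def)
      with True show ?thesis by (auto simp: e edges_def cut_edge_def)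
    next
      case False
      with \<open>c < 2 * m\<close> have "(c - 1, c) \<in> parcs (cycle_graph (2 * m))"
        by (auto simp: cycle_graph_def)
      with False show ?thesis by (auto simp: e edges_def cut_edge_def)
    qed
    moreover have "labels_are_distances (delete_edge (cycle_graph (2 * m)) e) L"
    proof (rule dist)
      fix s i assume s: "s \<in> {1..m}" "a s \<le> i" "i < a s + s"
      have "c \<le> a s \<or> a s + s < c" using c s by (simp add: cuts_def)
      \<comment> \<open>For \<open>c > 0\<close>, equality would give \<open>c = Suc i\<close>, a
        straddled cut. For \<open>c = 0\<close>, the closing edge joins no consecutive numbers, as
        there are at least four vertices.\<close>
      then have "{i, Suc i} \<noteq> e" using s \<open>m \<ge> 2\<close>
        by (auto simp: e cut_edge_def doubleton_eq_iff)
      then show "(i, Suc i) \<in> parcs (delete_edge (cycle_graph (2 * m)) e)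
          \<and> (Suc i, i) \<in> parcs (delete_edge (cycle_graph (2 * m)) e)"
        using arc[OF s] by (auto simp: delete_edge_def insert_commute)
    qed (auto simp: pair_wf_digraph_delete_edge pair_wf_digraph_cycle_graph,
         auto simp: delete_edge_def cycle_graph_def)
    ultimately show "e \<in> removable_edges m L" by (simp add: removable_edges_def)
  qed
  moreover have "inj_on (cut_edge (2 * m)) (cuts m a)"
    using \<open>m \<ge> 2\<close> by (auto simp: inj_on_def cut_edge_def doubleton_eq_iff split: if_splits)
  moreover have "finite (removable_edges m L)"
    by (rule finite_subset[of _ "Pow {..<2 * m}"])
      (auto simp: removable_edges_def edges_def cycle_graph_def)
  ultimately have "edge_removable_skolem_circle (card (cuts m a)) m L"
    unfolding edge_removable_skolem_circle_def by (metis card_image card_mono)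
  then show ?thesis by blast
qed

theorem theorem7:
  fixes j :: nat
  assumes "j \<ge> 1"
  shows "\<exists>L. edge_removable_skolem_circle (j + 1) ((3 ^ (j + 1) - 1) div 2) L"
proof -
  define m where "m = ((3::nat) ^ (j + 1) - 1) div 2"
  obtain a where "skolem_sequence m a" "j + 1 \<le> card (cuts m a)"
    using skolem_sequence_exists unfolding m_def by blast
  \<comment> \<open>This excludes order 1, where the closing edge would coincide with the edge
    between positions 0 and 1.\<close>
  moreover have "(3::nat) ^ 2 \<le> 3 ^ (j + 1)"
    using assms by (intro power_increasing) auto
  then have "m \<ge> 2" by (simp add: m_def)
  ultimately show ?thesis
    using skolem_circle_of_sequence[of m a] unfolding m_def edge_removable_skolem_circle_def
    by (meson order_trans)
qed

end
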